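(* Let $\nu\ge0$ and let $\mathbf{x}_i(t)\in\mathbb{R}^2$, $\Gamma_i(t)\in\mathbb{R}$ ($i=1,\dots,N$) be differentiable functions on a time interval that satisfy the system of ordinary differential equations $$\frac{\mathrm{d}\mathbf{x}_i}{\mathrm{d}t}=\sum_{j=1}^N\mathbf{K}(\mathbf{r}_{ij})\Gamma_j,\qquad \frac{\mathrm{d}\Gamma_i}{\mathrm{d}t}=\nu\sum_{j=1}^Nf_{ji}\Gamma_j,\qquad i=1,\dots,N,$$ where $\mathbf{r}_{ij}=\mathbf{x}_j-\mathbf{x}_i$ and, at each time $t$, the coefficients $f_{ij}=f_{ij}(t)$ are admissible stencils of order $n\in\{1,2\}$ for the positions $\mathbf{x}_1(t),\dots,\mathbf{x}_N(t)$ (see context). Then the vorticity field $\omega=\sum_{i=1}^N\Gamma_i\delta(\mathbf{x}-\mathbf{x}_i)$ conserves circulation as well as linear and angular momentum, in the sense that $$I_0:=\sum_{i=1}^N\Gamma_i,\qquad \mathbf{I}_1:=\sum_{i=1}^N\Gamma_i\mathbf{x}_i,\qquad I_2:=\sum_{i=1}^N\Gamma_i|\mathbf{x}_i|^2$$ satisfy the conservation laws $$\frac{\mathrm{d}I_0}{\mathrm{d}t}=0,\qquad \frac{\mathrm{d}\mathbf{I}_1}{\mathrm{d}t}=\mathbf{0},\qquad \frac{\mathrm{d}I_2}{\mathrm{d}t}=4\nu I_0.$$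
   Context: $\mathbf{K}:\mathbb{R}^2\to\mathbb{R}^2$ is the Biot--Savart kernel (with the sign convention used here): $\mathbf{K}(\mathbf{0})=\mathbf{0}$ and $\mathbf{K}(\mathbf{x})=\dfrac{(y,-x)^\top}{2\pi|\mathbf{x}|^2}$ for $\mathbf{x}=(x,y)\neq\mathbf{0}$. $I_0$, $\mathbf{I}_1$, $I_2$ are the circulation $\int\omega\,\mathrm{d}\mathbf{x}$, linear momentum $\int\omega\mathbf{x}\,\mathrm{d}\mathbf{x}$ and angular momentum $\int\omega\mathbf{x}^2\,\mathrm{d}\mathbf{x}$ of $\omega$. Admissible stencils of order $n$: write $\mathbf{r}_{ij}^x,\mathbf{r}_{ij}^y$ for the components of $\mathbf{r}_{ij}$ and $\mathbf{r}_{ij}^\alpha=(\mathbf{r}_{ij}^x)^{\alpha_1}(\mathbf{r}_{ij}^y)^{\alpha_2}$. For fixed $h>0$, $R>r>0$ let $\mathcal{N}_i:=\{j\in\{1,\dots,N\}: rh\le|\mathbf{x}_i-\mathbf{x}_j|\le Rh\}\cup\{i\}$. The real numbers $f_{ij}$ satisfy $f_{ij}=0$ for $j\notin\mathcal{N}_i$ and, for every $i$: $f_{ij}\ge0$ for $j\ne i$; $\sum_{j=1}^Nf_{ij}\mathbf{r}_{ij}^x\mathbf{r}_{ij}^x=2$, $\sum_{j=1}^Nf_{ij}\mathbf{r}_{ij}^y\mathbf{r}_{ij}^y=2$, $\sum_{j=1}^Nf_{ij}\mathbf{r}_{ij}^x\mathbf{r}_{ij}^y=0$; and $\sum_{j=1}^Nf_{ij}\mathbf{r}_{ij}^\alpha=0$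 for all multi-indices with $0\le|\alpha|\le n+1$, $|\alpha|\ne2$ (for $\alpha=(0,0)$: $f_{ii}=-\sum_{j\ne i}f_{ij}$). For indices $i$ with $\Gamma_i=0$ at the time considered (empty particles) it is also allowed that $f_{ij}=0$ for all $j$ instead. *)

theory Defs
  imports "HOL-Analysis.Analysis"
begin

definition biot_savart :: "real^2 \<Rightarrow> real^2" where
  "biot_savart z =
     (if z = 0 then 0 else (1 / (2 * pi * (norm z)\<^sup>2)) *\<^sub>R vector [z $ 2, - (z $ 1)])"

text \<open>Particles carry the indices \<open>1, \<dots>, N\<close>; positions, circulations and coefficients at
  indices outside this range are irrelevant and left unconstrained.\<close>

definition rel_pos :: "(nat \<Rightarrow> real^2) \<Rightarrow> nat \<Rightarrow> nat \<Rightarrow> real^2" where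
  "rel_pos x i j = x j - x i"

definition neighbours ::
  "real \<Rightarrow> real \<Rightarrow> real \<Rightarrow> nat \<Rightarrow> (nat \<Rightarrow> real^2) \<Rightarrow> nat \<Rightarrow> nat set" where
  "neighbours h r R N x i =
     {j \<in> {1..N}. r * h \<le> norm (x i - x j) \<and> norm (x i - x j) \<le> R * h} \<union> {i}"

text \<open>The moment conditions rely on the convention \<open>0 ^ 0 = 1\<close>: the multi-index \<open>(0, 0)\<close> gives
  \<open>(\<Sum>j\<in>{1..N}. f j) = 0\<close>, where \<open>j = i\<close> contributes the diagonal coefficient.\<close>

definition stencil ::
  "nat \<Rightarrow> real \<Rightarrow> real \<Rightarrow> real \<Rightarrow> nat \<Rightarrow> (nat \<Rightarrow> real^2) \<Rightarrow> nat \<Rightarrow> (nat \<Rightarrow> real) \<Rightarrow> bool" where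
  "stencil n h r R N x i f \<longleftrightarrow>
     (\<forall>j\<in>{1..N}. j \<notin> neighbours h r R N x i \<longrightarrow> f j = 0) \<and>
     (\<forall>j\<in>{1..N}. j \<noteq> i \<longrightarrow> f j \<ge> 0) \<and>
     (\<Sum>j\<in>{1..N}. f j * (rel_pos x i j $ 1) * (rel_pos x i j $ 1)) = 2 \<and>
     (\<Sum>j\<in>{1..N}. f j * (rel_pos x i j $ 2) * (rel_pos x i j $ 2)) = 2 \<and>
     (\<Sum>j\<in>{1..N}. f j * (rel_pos x i j $ 1) * (rel_pos x i j $ 2)) = 0 \<and>
     (\<forall>a b. a + b \<le> n + 1 \<and> a + b \<noteq> 2 \<longrightarrow>
        (\<Sum>j\<in>{1..N}. f j * ((rel_pos x i j $ 1) ^ a * (rel_pos x i j $ 2) ^ b)) = 0)"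

text \<open>Empty particles (zero circulation) may carry the zero stencil instead.\<close>

definition admissible_stencils ::
  "nat \<Rightarrow> real \<Rightarrow> real \<Rightarrow> real \<Rightarrow> nat \<Rightarrow> (nat \<Rightarrow> real^2) \<Rightarrow> (nat \<Rightarrow> real) \<Rightarrow>
   (nat \<Rightarrow> nat \<Rightarrow> real) \<Rightarrow> bool" where
  "admissible_stencils n h r R N x \<Gamma> f \<longleftrightarrow>
     (\<forall>i\<in>{1..N}. stencil n h r R N x i (f i) \<or> (\<Gamma> i = 0 \<and> (\<forall>j\<in>{1..N}. f i j = 0)))"

text \<open>The moments of the vorticity \<open>\<Sum>i. \<Gamma> i * \<delta>(\<cdot> - x i)\<close>, i.e. the integrals of \<open>1\<close>, of the
  identity and of the squared norm against this combination of Dirac masses.\<close>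

definition circulation :: "nat \<Rightarrow> (nat \<Rightarrow> real) \<Rightarrow> real" where
  "circulation N \<Gamma> = (\<Sum>i\<in>{1..N}. \<Gamma> i)"

definition linear_momentum :: "nat \<Rightarrow> (nat \<Rightarrow> real^2) \<Rightarrow> (nat \<Rightarrow> real) \<Rightarrow> real^2" where
  "linear_momentum N x \<Gamma> = (\<Sum>i\<in>{1..N}. \<Gamma> i *\<^sub>R x i)"

definition angular_momentum :: "nat \<Rightarrow> (nat \<Rightarrow> real^2) \<Rightarrow> (nat \<Rightarrow> real) \<Rightarrow> real" where
  "angular_momentum N x \<Gamma> = (\<Sum>i\<in>{1..N}. \<Gamma> i * (norm (x i))\<^sup>2)"

end

theory Submission
  imports Defs
begin

text \<open>Transposing the double sums turns the diffusive part of the time derivative of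
  \<open>\<Sum>i. \<Gamma> i * p (x i)\<close> into \<open>\<nu> * (\<Sum>j. \<Gamma> j * (\<Sum>i. f j i * p (x i)))\<close>, where the inner
  sum is the discrete Laplacian of \<open>p\<close> at \<open>x j\<close>; it is exact for the polynomials \<open>1\<close>, \<open>x\<close> and
  \<open>|x|\<^sup>2\<close>, with values \<open>0\<close>, \<open>0\<close> and \<open>4\<close>. The convective parts vanish as double sums of antisymmetric
  terms because the Biot--Savart kernel is odd and orthogonal to its argument.\<close>

text \<open>Exchanging the order of summation turns the double sum into its own negative, and in a
  real vector space only 0 equals its negative.\<close>

lemma sum_antisymmetric:
  fixes g :: "'a \<Rightarrow> 'a \<Rightarrow> 'b::real_vector"
  assumes "\<And>i j. i \<in> A \<Longrightarrow> j \<in> A \<Longrightarrow> g i j = - g j i"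
  shows "(\<Sum>i\<in>A. \<Sum>j\<in>A. g i j) = 0"
proof -
  have "(\<Sum>i\<in>A. \<Sum>j\<in>A. g i j) = (\<Sum>i\<in>A. \<Sum>j\<in>A. - g j i)"
    by (intro sum.cong refl assms)
  also have "\<dots> = - (\<Sum>j\<in>A. \<Sum>i\<in>A. g j i)"
    by (subst sum.swap) (simp add: sum_negf)
  finally have "2 *\<^sub>R (\<Sum>i\<in>A. \<Sum>j\<in>A. g i j) = 0"
    by (simp only: scaleR_2 eq_neg_iff_add_eq_0)
  then show ?thesis
    by simp
qed

text \<open>The value 0 at the origin makes oddness hold there too, so diagonal terms and coinciding
  particles are covered.\<close>

lemma biot_savart_minus: "biot_savart (- z) = - biot_savart z"
  by (auto simp: biot_savart_def vec_eq_iff forall_2)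

text \<open>Away from 0 the kernel is its argument turned by a right angle and rescaled.\<close>

lemma inner_biot_savart: "z \<bullet> biot_savart z = 0"
  by (auto simp: biot_savart_def inner_vec_def sum_2)

lemma biot_savart_rel_pos_commute:
  "biot_savart (rel_pos x i j) = - biot_savart (rel_pos x j i)"
  unfolding rel_pos_def by (metis biot_savart_minus minus_diff_eq)

lemma convection_linear_momentum:
  "(\<Sum>i\<in>A. \<Gamma> i *\<^sub>R (\<Sum>j\<in>A. \<Gamma> j *\<^sub>R biot_savart (rel_pos x i j))) = 0"
proof -
  have "(\<Sum>i\<in>A. \<Sum>j\<in>A. \<Gamma> i *\<^sub>R \<Gamma> j *\<^sub>R biot_savart (rel_pos x i j)) = 0"
    by (rule sum_antisymmetric, subst biot_savart_rel_pos_commute) (simp add: mult.commute)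
  then show ?thesis
    by (simp add: scaleR_sum_right)
qed

lemma convection_angular_momentum:
  "(\<Sum>i\<in>A. \<Gamma> i * (x i \<bullet> (\<Sum>j\<in>A. \<Gamma> j *\<^sub>R biot_savart (rel_pos x i j)))) = 0"
proof -
  have "x i \<bullet> biot_savart (rel_pos x i j) = - (x j \<bullet> biot_savart (rel_pos x j i))" for i j
  proof -
    \<comment> \<open>Orthogonality allows \<open>x i\<close> to be exchanged for \<open>x j\<close>
      in the inner product; oddness of the kernel then supplies the sign.\<close>
    have "(x j - x i) \<bullet> biot_savart (rel_pos x i j) = 0"
      unfolding rel_pos_def by (rule inner_biot_savart)
    then show ?thesis
      by (simp add: biot_savart_rel_pos_commute[of x j i] inner_diff_left)
  qed
  then have "(\<Sum>i\<in>A. \<Sum>j\<in>A. \<Gamma> i * (\<Gamma> j * (x i \<bullet> biot_savart (rel_pos x i j)))) = 0"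
    by (intro sum_antisymmetric) (metis mult.left_commute mult_minus_right)
  then show ?thesis
    by (simp add: inner_sum_right sum_distrib_left)
qed

lemma stencil_moments:
  assumes "stencil n h r R N x i f"
  shows stencil_sum: "(\<Sum>j\<in>{1..N}. f j) = 0"
    and stencil_first_moment: "(\<Sum>j\<in>{1..N}. f j *\<^sub>R rel_pos x i j) = 0"
    and stencil_second_moment: "(\<Sum>j\<in>{1..N}. f j * (norm (rel_pos x i j))\<^sup>2) = 4"
proof -
  have mom: "(\<Sum>j\<in>{1..N}. f j * ((rel_pos x i j $ 1) ^ a * (rel_pos x i j $ 2) ^ b)) = 0"
    if "a + b \<le> n + 1" "a + b \<noteq> 2" for a b
    using assms that unfolding stencil_def by blast
  show "(\<Sum>j\<in>{1..N}. f j) = 0"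
    using mom[of 0 0] by simp
  show "(\<Sum>j\<in>{1..N}. f j *\<^sub>R rel_pos x i j) = 0"
    using mom[of 1 0] mom[of 0 1] by (simp add: vec_eq_iff forall_2)
  \<comment> \<open>The squared norm is the trace of the second-moment matrix, whose diagonal
    entries are both 2.\<close>
  have "(\<Sum>j\<in>{1..N}. f j * (norm (rel_pos x i j))\<^sup>2) =
      (\<Sum>j\<in>{1..N}. f j * (rel_pos x i j $ 1) * (rel_pos x i j $ 1)) +
      (\<Sum>j\<in>{1..N}. f j * (rel_pos x i j $ 2) * (rel_pos x i j $ 2))"
    by (simp add: power2_norm_eq_inner inner_vec_def sum_2 algebra_simps sum.distrib)
  also have "\<dots> = 4"
    using assms unfolding stencil_def by linarith
  finally show "(\<Sum>j\<in>{1..N}. f j * (norm (rel_pos x i j))\<^sup>2) = 4" .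
qed

text \<open>With \<open>x j = x i + rel_pos x i j\<close>, the constant part is killed by the zeroth
  moment and the rest is the first moment.\<close>

lemma stencil_sum_position:
  assumes "stencil n h r R N x i f"
  shows "(\<Sum>j\<in>{1..N}. f j *\<^sub>R x j) = 0"
proof -
  have "(\<Sum>j\<in>{1..N}. f j *\<^sub>R x j) =
      (\<Sum>j\<in>{1..N}. f j) *\<^sub>R x i + (\<Sum>j\<in>{1..N}. f j *\<^sub>R rel_pos x i j)"
    by (simp add: rel_pos_def scaleR_sum_left flip: sum.distrib scaleR_add_right)
  then show ?thesis
    by (simp only: stencil_moments[OF assms]) simp
qed

text \<open>Expanding the squared norm about the centre \<open>x i\<close> leaves the zeroth, first
  and second moments, which are 0, 0 and 4.\<close>

lemma stencil_sum_norm_squared: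
  assumes "stencil n h r R N x i f"
  shows "(\<Sum>j\<in>{1..N}. f j * (norm (x j))\<^sup>2) = 4"
proof -
  have norm_eq: "(norm (x j))\<^sup>2 =
      (norm (x i))\<^sup>2 + 2 * (x i \<bullet> rel_pos x i j) + (norm (rel_pos x i j))\<^sup>2" for j
    by (simp add: rel_pos_def power2_norm_eq_inner inner_diff_left inner_diff_right inner_commute)
  have "(\<Sum>j\<in>{1..N}. f j * (norm (x j))\<^sup>2) =
      (\<Sum>j\<in>{1..N}. f j * (norm (x i))\<^sup>2 + 2 * (x i \<bullet> (f j *\<^sub>R rel_pos x i j))
        + f j * (norm (rel_pos x i j))\<^sup>2)"
    by (intro sum.cong refl, subst norm_eq) (simp add: algebra_simps)
  also have "\<dots> = (\<Sum>j\<in>{1..N}. f j) * (norm (x i))\<^sup>2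
      + 2 * (x i \<bullet> (\<Sum>j\<in>{1..N}. f j *\<^sub>R rel_pos x i j))
      + (\<Sum>j\<in>{1..N}. f j * (norm (rel_pos x i j))\<^sup>2)"
    by (simp only: sum.distrib sum_distrib_left sum_distrib_right inner_sum_right)
  also have "\<dots> = 4"
    by (simp only: stencil_moments[OF assms]) simp
  finally show ?thesis .
qed

text \<open>Here \<open>c\<close> is the common value of the discrete Laplacian of \<open>p\<close>
  at all particles with a genuine stencil. Letting \<open>p\<close> range over any real vector space
  serves scalar and vector moments alike.\<close>

lemma diffusion_moment:
  fixes p :: "nat \<Rightarrow> 'b::real_vector"
  assumes "admissible_stencils n h r R N x \<Gamma> f"
    and "\<And>j. stencil n h r R N x j (f j) \<Longrightarrow> (\<Sum>i\<in>{1..N}. f j i *\<^sub>R p i) = c"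
  shows "(\<Sum>i\<in>{1..N}. (\<nu> * (\<Sum>j\<in>{1..N}. f j i * \<Gamma> j)) *\<^sub>R p i) =
    (\<nu> * circulation N \<Gamma>) *\<^sub>R c"
proof -
  have "(\<Sum>i\<in>{1..N}. (\<nu> * (\<Sum>j\<in>{1..N}. f j i * \<Gamma> j)) *\<^sub>R p i) =
      (\<Sum>i\<in>{1..N}. \<Sum>j\<in>{1..N}. (\<nu> * \<Gamma> j) *\<^sub>R f j i *\<^sub>R p i)"
    by (simp add: sum_distrib_left scaleR_sum_left mult_ac)
  also have "\<dots> = (\<Sum>j\<in>{1..N}. (\<nu> * \<Gamma> j) *\<^sub>R (\<Sum>i\<in>{1..N}. f j i *\<^sub>R p i))"
    by (subst sum.swap) (simp only: scaleR_sum_right)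
  \<comment> \<open>A particle with the zero stencil has \<open>\<Gamma> j = 0\<close>, so its two
    summands agree even though its inner sum need not be \<open>c\<close>.\<close>
  also have "\<dots> = (\<Sum>j\<in>{1..N}. (\<nu> * \<Gamma> j) *\<^sub>R c)"
    using assms unfolding admissible_stencils_def by (intro sum.cong refl) force
  also have "\<dots> = (\<nu> * circulation N \<Gamma>) *\<^sub>R c"
    by (simp add: circulation_def sum_distrib_left scaleR_sum_left)
  finally show ?thesis .
qed

theorem theorem3:
  fixes \<nu> h r R :: real
    and n N :: nat
    and T :: "real set"
    and x :: "real \<Rightarrow> nat \<Rightarrow> real^2"
    and \<Gamma> :: "real \<Rightarrow> nat \<Rightarrow> real"
    and f :: "real \<Rightarrow> nat \<Rightarrow> nat \<Rightarrow> real"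
  assumes "\<nu> \<ge> 0" and "h > 0" and "r > 0" and "R > r" and "n \<in> {1, 2}"
    and "is_interval T"
    and "\<And>t. t \<in> T \<Longrightarrow> admissible_stencils n h r R N (x t) (\<Gamma> t) (f t)"
    and "\<And>t i. t \<in> T \<Longrightarrow> i \<in> {1..N} \<Longrightarrow>
           ((\<lambda>s. x s i) has_vector_derivative
              (\<Sum>j\<in>{1..N}. \<Gamma> t j *\<^sub>R biot_savart (rel_pos (x t) i j))) (at t within T)"
    and "\<And>t i. t \<in> T \<Longrightarrow> i \<in> {1..N} \<Longrightarrow>
           ((\<lambda>s. \<Gamma> s i) has_real_derivative \<nu> * (\<Sum>j\<in>{1..N}. f t j i * \<Gamma> t j)) (at t within T)"
  shows "\<forall>t\<in>T.
     ((\<lambda>s. circulation N (\<Gamma> s)) has_real_derivative 0) (at t within T) \<and>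
     ((\<lambda>s. linear_momentum N (x s) (\<Gamma> s)) has_vector_derivative 0) (at t within T) \<and>
     ((\<lambda>s. angular_momentum N (x s) (\<Gamma> s)) has_real_derivative
        4 * \<nu> * circulation N (\<Gamma> t)) (at t within T)"
proof (intro ballI conjI)
  fix t assume t: "t \<in> T"
  note adm = assms(7)[OF t]
  define v where "v i = (\<Sum>j\<in>{1..N}. \<Gamma> t j *\<^sub>R biot_savart (rel_pos (x t) i j))" for i
  define g where "g i = \<nu> * (\<Sum>j\<in>{1..N}. f t j i * \<Gamma> t j)" for i
  have x': "((\<lambda>s. x s i) has_vector_derivative v i) (at t within T)" if "i \<in> {1..N}" for i
    using assms(8)[OF t that] unfolding v_def .
  have \<Gamma>': "((\<lambda>s. \<Gamma> s i) has_real_derivative g i) (at t within T)" if "i \<in> {1..N}" for i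
    using assms(9)[OF t that] unfolding g_def .
  \<comment> \<open>The product rule for the inner product of the path with itself gives two terms,
    equal by symmetry.\<close>
  have norm_x': "((\<lambda>s. (norm (x s i))\<^sup>2) has_real_derivative 2 * (x t i \<bullet> v i)) (at t within T)"
    if "i \<in> {1..N}" for i
    using bounded_bilinear.has_vector_derivative[OF bounded_bilinear_inner x'[OF that] x'[OF that]]
    by (simp add: has_real_derivative_iff_has_vector_derivative power2_norm_eq_inner inner_commute)
  have g0: "(\<Sum>i\<in>{1..N}. g i) = 0"
    using diffusion_moment[OF adm, of "\<lambda>_. 1::real" 0 \<nu>] stencil_sum by (simp add: g_def)
  have g1: "(\<Sum>i\<in>{1..N}. g i *\<^sub>R x t i) = 0"
    using diffusion_moment[OF adm, of "x t" 0 \<nu>] stencil_sum_position by (simp add: g_def)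
  have g2: "(\<Sum>i\<in>{1..N}. g i * (norm (x t i))\<^sup>2) = 4 * \<nu> * circulation N (\<Gamma> t)"
    using diffusion_moment[OF adm, of "\<lambda>i. (norm (x t i))\<^sup>2" 4 \<nu>] stencil_sum_norm_squared
    by (simp add: g_def)
  show "((\<lambda>s. circulation N (\<Gamma> s)) has_real_derivative 0) (at t within T)"
    unfolding circulation_def by (rule DERIV_cong[OF DERIV_sum g0]) (rule \<Gamma>')
  have "((\<lambda>s. linear_momentum N (x s) (\<Gamma> s)) has_vector_derivative
      (\<Sum>i\<in>{1..N}. \<Gamma> t i *\<^sub>R v i + g i *\<^sub>R x t i)) (at t within T)"
    unfolding linear_momentum_def
    by (intro has_vector_derivative_sum has_vector_derivative_scaleR x' \<Gamma>')
  \<comment> \<open>Transport and diffusion cancel separately: the first by antisymmetry, the second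
    by \<open>g1\<close>.\<close>
  moreover have "(\<Sum>i\<in>{1..N}. \<Gamma> t i *\<^sub>R v i + g i *\<^sub>R x t i) = 0"
    unfolding sum.distrib g1 unfolding v_def convection_linear_momentum by simp
  ultimately show "((\<lambda>s. linear_momentum N (x s) (\<Gamma> s)) has_vector_derivative 0) (at t within T)"
    by simp
  have "((\<lambda>s. angular_momentum N (x s) (\<Gamma> s)) has_real_derivative
      (\<Sum>i\<in>{1..N}. g i * (norm (x t i))\<^sup>2 + 2 * (x t i \<bullet> v i) * \<Gamma> t i)) (at t within T)"
    unfolding angular_momentum_def by (intro DERIV_sum DERIV_mult norm_x' \<Gamma>')
  \<comment> \<open>Once diffusion and transport are separated, only the diffusive sum
    \<open>g2\<close> survives.\<close>
  moreover have "(\<Sum>i\<in>{1..N}. g i * (norm (x t i))\<^sup>2 + 2 * (x t i \<bullet> v i) * \<Gamma> t i) =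
      (\<Sum>i\<in>{1..N}. g i * (norm (x t i))\<^sup>2) + 2 * (\<Sum>i\<in>{1..N}. \<Gamma> t i * (x t i \<bullet> v i))"
    by (simp add: sum.distrib sum_distrib_left mult_ac)
  moreover have "(\<Sum>i\<in>{1..N}. \<Gamma> t i * (x t i \<bullet> v i)) = 0"
    unfolding v_def by (rule convection_angular_momentum)
  ultimately show "((\<lambda>s. angular_momentum N (x s) (\<Gamma> s)) has_real_derivative
      4 * \<nu> * circulation N (\<Gamma> t)) (at t within T)"
    using g2 by simp
qed

end
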